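(* The superadditivity principle for inability, $(\mathrm{Iab}_C\varphi\wedge\mathrm{Iab}_D\psi)\rightarrow\mathrm{Iab}_{C\cup D}(\varphi\wedge\psi)$, is not valid in general, even when $C\cap D=\emptyset$: there exist a finite non-empty set of agents $N$, disjoint coalitions $C,D\subseteq N$, formulas $\varphi,\psi$, a coalition model $\mathcal{M}$ over $N$ and a state $s$ with $\mathcal{M},s\models\mathrm{Iab}_C\varphi\wedge\mathrm{Iab}_D\psi$ and $\mathcal{M},s\not\models\mathrm{Iab}_{C\cup D}(\varphi\wedge\psi)$.
   Context: A coalition is any $C\subseteq N$, $\overline{C}=N\setminus C$. Formulas: $\varphi ::= p \mid \neg\varphi \mid (\varphi\wedge\psi) \mid [C]\varphi \mid \mathrm{Iab}_C\varphi$ over a countable set $\mathrm{Prop}$ of variables. A coalition model is $\mathcal{M}=(S,\{Act_i\}_{i\in N},o,V)$ with $S$ non-empty, each $Act_i$ non-empty, $o:S\times\prod_{i\in N}Act_i\to S$, $V:\mathrm{Prop}\to 2^S$; $Act_C=\prod_{i\in C}Act_i$ ($Act_\emptyset$ contains only the empty profile). $\mathcal{M},s\models[C]\varphi$ iff there is $\sigma_C\in Act_C$ such that for all $\sigma_{\overline{C}}\in Act_{\overline{C}}$, $\mathcal{M},o(s,\sigma_C,\sigma_{\overline{C}})\models\varphi$; $\mathcal{M},s\models\mathrm{Iab}_C\varphi$ iff $\mathcal{M},s\not\models[C]\varphi$; atoms and Boolean connectives as usual. *)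

theory Defs
  imports Main "HOL-Library.FuncSet" "HOL-Library.Countable"
begin

datatype ('i, 'p) form =
    Atom 'p
  | Neg "('i, 'p) form"
  | Conj "('i, 'p) form" "('i, 'p) form"
  | Can "'i set" "('i, 'p) form"
  | Iab "'i set" "('i, 'p) form"

text \<open>The formulas of the language over the agent set \<open>N\<close> are those in which every coalition
  is a subset of \<open>N\<close>.\<close>

primrec form_over :: "'i set \<Rightarrow> ('i, 'p) form \<Rightarrow> bool" where
  "form_over N (Atom p) \<longleftrightarrow> True"
| "form_over N (Neg \<phi>) \<longleftrightarrow> form_over N \<phi>"
| "form_over N (Conj \<phi> \<psi>) \<longleftrightarrow> form_over N \<phi> \<and> form_over N \<psi>"
| "form_over N (Can C \<phi>) \<longleftrightarrow> C \<subseteq> N \<and> form_over N \<phi>"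
| "form_over N (Iab C \<phi>) \<longleftrightarrow> C \<subseteq> N \<and> form_over N \<phi>"

record ('i, 's, 'a, 'p) model =
  states :: "'s set"
  act :: "'i \<Rightarrow> 'a set"
  outcome :: "'s \<Rightarrow> ('i \<Rightarrow> 'a) \<Rightarrow> 's"
  val :: "'p \<Rightarrow> 's set"

text \<open>A profile of \<open>C\<close> is an extensional function on \<open>C\<close>, so the empty coalition has
  exactly one profile.\<close>

definition profiles :: "('i, 's, 'a, 'p) model \<Rightarrow> 'i set \<Rightarrow> ('i \<Rightarrow> 'a) set" where
  "profiles M C = PiE C (act M)"

definition coalition_model :: "'i set \<Rightarrow> ('i, 's, 'a, 'p) model \<Rightarrow> bool" where
  "coalition_model N M \<longleftrightarrow>
     states M \<noteq> {} \<and>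
     (\<forall>i\<in>N. act M i \<noteq> {}) \<and>
     (\<forall>s\<in>states M. \<forall>\<sigma>\<in>profiles M N. outcome M s \<sigma> \<in> states M) \<and>
     (\<forall>p. val M p \<subseteq> states M)"

text \<open>For \<open>C \<subseteq> N\<close>, \<open>override_on \<tau> \<sigma> C\<close> is the joint profile of \<open>N\<close> that agrees with \<open>\<sigma>\<close>
  on \<open>C\<close> and with \<open>\<tau>\<close> on \<open>N - C\<close>.\<close>

definition can_force ::
  "'i set \<Rightarrow> ('i, 's, 'a, 'p) model \<Rightarrow> 's \<Rightarrow> 'i set \<Rightarrow> ('s \<Rightarrow> bool) \<Rightarrow> bool" where
  "can_force N M s C P \<longleftrightarrow>
     (\<exists>\<sigma>\<in>profiles M C. \<forall>\<tau>\<in>profiles M (N - C). P (outcome M s (override_on \<tau> \<sigma> C)))"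

primrec sat :: "'i set \<Rightarrow> ('i, 's, 'a, 'p) model \<Rightarrow> 's \<Rightarrow> ('i, 'p) form \<Rightarrow> bool" where
  "sat N M s (Atom p) \<longleftrightarrow> s \<in> val M p"
| "sat N M s (Neg \<phi>) \<longleftrightarrow> \<not> sat N M s \<phi>"
| "sat N M s (Conj \<phi> \<psi>) \<longleftrightarrow> sat N M s \<phi> \<and> sat N M s \<psi>"
| "sat N M s (Can C \<phi>) \<longleftrightarrow> can_force N M s C (\<lambda>t. sat N M t \<phi>)"
| "sat N M s (Iab C \<phi>) \<longleftrightarrow> \<not> can_force N M s C (\<lambda>t. sat N M t \<phi>)"

lemma sat_Iab_iff: "sat N M s (Iab C \<phi>) \<longleftrightarrow> \<not> sat N M s (Can C \<phi>)"
  by simp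

end

(* Two agents each choose 0 or 1 and the outcome is the product of their choices. Either agent
   can make the outcome 0, so neither can force 1 alone, but together they can. *)
theory Submission imports Defs begin

text \<open>Pooling agents also removes opponents, so two inabilities need not add up. Both formulas
  are one atom \<open>p\<close>, true exactly at 1. Each singleton is blocked by the other agent
  (\<open>singleton_cannot_force_1\<close>), whereas the union is the grand coalition, which fixes
  the outcome (\<open>both_can_force_1\<close>). The outcome ignores the current state, so any state
  serves.\<close>

definition product_game :: "(nat, nat, nat, 'p) model" where
  "product_game =
     \<lparr>states = {0, 1}, act = (\<lambda>_. {0, 1}), outcome = (\<lambda>_ \<sigma>. \<sigma> 0 * \<sigma> 1), val = (\<lambda>_. {1})\<rparr>"

lemma coalition_model_product_game: "coalition_model {0, 1} product_game"
proof -
  have "\<sigma> 0 * \<sigma> 1 \<in> {0, 1 :: nat}" if "\<sigma> \<in> PiE {0, 1} (\<lambda>_. {0, 1})" for \<sigma> :: "nat \<Rightarrow> nat"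
    using PiE_mem[OF that, of 0] PiE_mem[OF that, of 1] by fastforce
  then show ?thesis
    by (simp only: coalition_model_def product_game_def profiles_def model.simps) blast
qed

lemma singleton_cannot_force_1:
  assumes "i \<in> {0, 1}"
  shows "\<not> can_force {0, 1} product_game s {i} (\<lambda>t. t = 1)"
proof -
  have "\<exists>\<tau>\<in>profiles product_game ({0, 1} - {i}).
      outcome product_game s (override_on \<tau> \<sigma> {i}) \<noteq> 1" for \<sigma>
    \<comment> \<open>The opponent plays 0, which makes the product 0 whatever \<open>i\<close>
      plays.\<close>
    by (rule bexI[of _ "restrict (\<lambda>_. 0) ({0, 1} - {i})"])
      (use assms in \<open>auto simp: profiles_def product_game_def override_on_def\<close>)
  then show ?thesis
    unfolding can_force_def by blast
qed

lemma both_can_force_1: "can_force {0, 1} product_game s {0, 1} (\<lambda>t. t = 1)"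
  unfolding can_force_def
  \<comment> \<open>Both play 1; nobody is left outside the coalition to interfere.\<close>
  by (rule bexI[of _ "restrict (\<lambda>_. 1) {0, 1}"])
    (auto simp: profiles_def product_game_def override_on_def)

theorem theorem4p17:
  "\<exists>(N :: nat set) C D (\<phi> :: (nat, 'p :: countable) form) \<psi>
      (M :: (nat, nat, nat, 'p) model) s.
     finite N \<and> N \<noteq> {} \<and> C \<subseteq> N \<and> D \<subseteq> N \<and> C \<inter> D = {} \<and>
     form_over N \<phi> \<and> form_over N \<psi> \<and>
     coalition_model N M \<and> s \<in> states M \<and>
     sat N M s (Conj (Iab C \<phi>) (Iab D \<psi>)) \<and>
     \<not> sat N M s (Iab (C \<union> D) (Conj \<phi> \<psi>))"
proof -
  \<comment> \<open>Any atom will do, since the valuation is the same for all; one exists because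
    types are inhabited.\<close>
  fix p :: 'p
  let ?M = "product_game :: (nat, nat, nat, 'p) model"
  have val: "t \<in> val ?M p \<longleftrightarrow> t = 1" for t
    by (simp add: product_game_def)
  have "sat {0, 1} ?M 0 (Conj (Iab {0} (Atom p)) (Iab {1} (Atom p)))"
    by (simp only: sat.simps val) (simp only: singleton_cannot_force_1 insert_iff simp_thms)
  moreover have "{0} \<union> {1} = {0, 1 :: nat}"
    by blast
  then have "\<not> sat {0, 1} ?M 0 (Iab ({0} \<union> {1}) (Conj (Atom p) (Atom p)))"
    \<comment> \<open>As \<phi> and \<psi> coincide, their conjunction collapses to the outcome
      being 1.\<close>
    by (simp only: sat.simps val conj_absorb not_not both_can_force_1)
  moreover have "0 \<in> states ?M"
    by (simp add: product_game_def)
  moreover have "finite {0, 1 :: nat}" "{0, 1 :: nat} \<noteq> {}" "{0} \<subseteq> {0, 1 :: nat}"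
    "{1} \<subseteq> {0, 1 :: nat}" "{0} \<inter> {1 :: nat} = {}" "form_over {0, 1} (Atom p)"
    by simp_all
  moreover have "coalition_model {0, 1} ?M"
    by (rule coalition_model_product_game)
  ultimately show ?thesis
    by - (rule exI[of _ "{0, 1}"], rule exI[of _ "{0}"], rule exI[of _ "{1}"],
      rule exI[of _ "Atom p"], rule exI[of _ "Atom p"], rule exI[of _ ?M], rule exI[of _ 0],
      intro conjI)
qed

end
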